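(* Let $C=\left(\frac{2^{18}}{2^{18}-1}\right)^{1/20}>1$ and, for each integer $N\ge 2$, let $d_N=\frac{1}{\cos\frac{\pi}{4N}}$. There exists $N_0$ such that for every integer $N\ge N_0$ the planar (symmetric) Banach--Mazur compactum contains a $d_N^2$-equilateral set of cardinality at least $C^N$. That is, there is a set $\mathcal{E}$ of (linear equivalence classes of) origin-symmetric convex bodies in $\mathbb{R}^2$ with $|\mathcal{E}|\ge C^N$ such that $d_{BM}(K,L)=d_N^2$ for any two different members $K,L$ of $\mathcal{E}$.
   Context: A convex body in $\mathbb{R}^2$ is a compact convex set with non-empty interior; it is origin-symmetric if $K=-K$. For two origin-symmetric convex bodies $K,L\subseteq\mathbb{R}^n$ the Banach--Mazur distance is $$d_{BM}(K,L)=\inf\{r>0:\ K\subseteq T(L)\subseteq rK\},$$ where the infimum is taken over all $r > 0$ and all invertible linear operators $T:\mathbb{R}^n\to\mathbb{R}^n$ satisfying the inclusions. Equivalently, for real $n$-dimensional normed spaces $X,Y$ with unit balls $B_X, B_Y$, $d_{BM}(B_X,B_Y)=\inf\|T\|\cdot\|T^{-1}\|$ over all invertible linear operators $T:X\to Y$. It is a multiplicative distance, equal to $1$ exactly when $K$ and $L$ are linearly equivalent (i.e. when the corresponding normed spaces are isometric). The (symmetric) planar Banach--Mazur compactum is the set of linear equivalence classes of origin-symmetric convex bodies in $\mathbb{R}^2$ (equivalently, isometry classes of real 2-dimensional normed spaces) equipped with $d_{BM}$. A $d$-equilateral set is a set in which every two different elements are at distance exactly $d$. *)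

theory Defs
  imports "HOL-Analysis.Analysis"
begin

definition symmetric_convex_body :: "'a::euclidean_space set \<Rightarrow> bool" where
  "symmetric_convex_body K \<longleftrightarrow>
     compact K \<and> convex K \<and> interior K \<noteq> {} \<and> K = uminus ` K"

definition banach_mazur_dist :: "'a::euclidean_space set \<Rightarrow> 'a set \<Rightarrow> real" where
  "banach_mazur_dist K L =
     Inf {r. r > 0 \<and> (\<exists>T. linear T \<and> bij T \<and> K \<subseteq> T ` L \<and> T ` L \<subseteq> (*\<^sub>R) r ` K)}"

definition linear_equivalence :: "('a::euclidean_space set \<times> 'a set) set" where
  "linear_equivalence = {(K, L). symmetric_convex_body K \<and> symmetric_convex_body L \<and>
     (\<exists>T. linear T \<and> bij T \<and> L = T ` K)}"

definition banach_mazur_compactum :: "'a::euclidean_space set set set" where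
  "banach_mazur_compactum = {K. symmetric_convex_body K} // linear_equivalence"

(* The distance of two classes is the common value of the distance over all pairs of
   representatives; lemma class_dist_eq shows that it is well defined. *)
definition banach_mazur_class_dist ::
    "'a::euclidean_space set set \<Rightarrow> 'a set set \<Rightarrow> real" where
  "banach_mazur_class_dist X Y = the_elem (\<Union>K\<in>X. \<Union>L\<in>Y. {banach_mazur_dist K L})"

definition equilateral :: "('b \<Rightarrow> 'b \<Rightarrow> real) \<Rightarrow> real \<Rightarrow> 'b set \<Rightarrow> bool" where
  "equilateral \<delta> d E \<longleftrightarrow> (\<forall>x\<in>E. \<forall>y\<in>E. x \<noteq> y \<longrightarrow> \<delta> x y = d)"

lemma linear_bij_inv:
  fixes T :: "'a::euclidean_space \<Rightarrow> 'a"
  assumes "linear T" "bij T"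
  shows "linear (inv T)" "bij (inv T)" "inv T ` T ` S = S"
proof -
  show "linear (inv T)"
  proof -
    obtain g where g: "linear g" "g \<circ> T = id"
      using linear_injective_left_inverse[OF assms(1) bij_is_inj[OF assms(2)]] by blast
    have "inv T = g"
    proof
      fix y
      have "g (T (inv T y)) = inv T y" using g(2) by (simp add: fun_eq_iff)
      then show "inv T y = g y" using assms(2) by (simp add: bij_is_surj surj_f_inv_f)
    qed
    then show ?thesis using g(1) by simp
  qed
  show "bij (inv T)" using assms(2) by (rule bij_imp_bij_inv)
  show "inv T ` T ` S = S" using assms(2) by (simp add: bij_is_inj)
qed

lemma equiv_linear_equivalence:
  "equiv {K :: 'a::euclidean_space set. symmetric_convex_body K} linear_equivalence"
proof (rule equivI)
  show "linear_equivalence \<subseteq>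
      {K :: 'a set. symmetric_convex_body K} \<times> {K. symmetric_convex_body K}"
    by (auto simp: linear_equivalence_def)
  show "refl_on {K :: 'a set. symmetric_convex_body K} linear_equivalence"
    unfolding refl_on_def linear_equivalence_def
    using linear_id bij_id image_id by fastforce
  show "sym (linear_equivalence :: ('a set \<times> 'a set) set)"
  proof (rule symI)
    fix K L :: "'a set"
    assume "(K, L) \<in> linear_equivalence"
    then obtain T where T: "linear T" "bij T" "L = T ` K"
      and KL: "symmetric_convex_body K" "symmetric_convex_body L"
      unfolding linear_equivalence_def by blast
    have "K = inv T ` L" using linear_bij_inv(3)[OF T(1,2)] T(3) by simp
    then show "(L, K) \<in> linear_equivalence"
      unfolding linear_equivalence_def using linear_bij_inv(1,2)[OF T(1,2)] KL by blast
  qed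
  show "trans (linear_equivalence :: ('a set \<times> 'a set) set)"
  proof (rule transI)
    fix K L M :: "'a set"
    assume "(K, L) \<in> linear_equivalence" "(L, M) \<in> linear_equivalence"
    then obtain T U where T: "linear T" "bij T" "L = T ` K"
      and U: "linear U" "bij U" "M = U ` L"
      and KM: "symmetric_convex_body K" "symmetric_convex_body M"
      unfolding linear_equivalence_def by blast
    have "M = (U \<circ> T) ` K" using T(3) U(3) by (simp only: image_comp)
    then show "(K, M) \<in> linear_equivalence"
      unfolding linear_equivalence_def
      using linear_compose[OF T(1) U(1)] bij_comp[OF T(2) U(2)] KM by blast
  qed
qed

lemma banach_mazur_dist_linear_image:
  fixes A B :: "'a::euclidean_space \<Rightarrow> 'a"
  assumes A: "linear A" "bij A" and B: "linear B" "bij B"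
  shows "banach_mazur_dist (A ` K) (B ` L) = banach_mazur_dist K L"
proof -
  define S where "S K L = {r. r > 0 \<and> (\<exists>T. linear T \<and> bij T \<and> K \<subseteq> T ` L \<and>
     T ` L \<subseteq> (*\<^sub>R) r ` K)}" for K L :: "'a set"
  have *: "S K L \<subseteq> S (A ` K) (B ` L)"
    if A: "linear A" "bij A" and B: "linear B" "bij B"
    for A B :: "'a \<Rightarrow> 'a" and K L :: "'a set"
  proof
    fix r assume "r \<in> S K L"
    then obtain T where T: "r > 0" "linear T" "bij T" "K \<subseteq> T ` L" "T ` L \<subseteq> (*\<^sub>R) r ` K"
      by (auto simp: S_def)
    let ?T = "A \<circ> (T \<circ> inv B)"
    have im: "?T ` B ` L = A ` T ` L"
      using linear_bij_inv(3)[OF B] by (simp only: image_comp[symmetric])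
    have "A ` T ` L \<subseteq> A ` (*\<^sub>R) r ` K"
      using T(5) by (rule image_mono)
    also have "\<dots> = (*\<^sub>R) r ` A ` K"
      using A(1) by (simp add: image_image linear_scale)
    finally have "?T ` B ` L \<subseteq> (*\<^sub>R) r ` A ` K" by (simp only: im)
    moreover have "A ` K \<subseteq> ?T ` B ` L"
      unfolding im using T(4) by (rule image_mono)
    moreover have "linear ?T"
      by (intro linear_compose linear_bij_inv(1) A B T)
    moreover have "bij ?T"
      by (intro bij_comp linear_bij_inv(2) A B T)
    ultimately show "r \<in> S (A ` K) (B ` L)"
      using T(1) unfolding S_def by blast
  qed
  have "S (A ` K) (B ` L) \<subseteq> S (inv A ` A ` K) (inv B ` B ` L)"
    by (rule *[OF linear_bij_inv(1,2)[OF A] linear_bij_inv(1,2)[OF B]])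
  then have "S (A ` K) (B ` L) \<subseteq> S K L"
    by (simp only: linear_bij_inv(3)[OF A] linear_bij_inv(3)[OF B])
  then have "S (A ` K) (B ` L) = S K L"
    using *[OF A B, of K L] by (rule subset_antisym)
  then show ?thesis by (simp add: banach_mazur_dist_def S_def)
qed

lemma class_dist_eq:
  fixes K L :: "'a::euclidean_space set"
  assumes "symmetric_convex_body K" "symmetric_convex_body L"
  shows "banach_mazur_class_dist (linear_equivalence `` {K}) (linear_equivalence `` {L})
       = banach_mazur_dist K L"
proof -
  have "banach_mazur_dist K' L' = banach_mazur_dist K L"
    if "(K, K') \<in> linear_equivalence" "(L, L') \<in> linear_equivalence" for K' L'
    using that by (auto simp: linear_equivalence_def banach_mazur_dist_linear_image)
  moreover have "(K, K) \<in> linear_equivalence" "(L, L) \<in> linear_equivalence"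
    using assms equiv_class_self[OF equiv_linear_equivalence] by auto
  ultimately have "(\<Union>K'\<in>linear_equivalence `` {K}. \<Union>L'\<in>linear_equivalence `` {L}.
      {banach_mazur_dist K' L'}) = {banach_mazur_dist K L}"
    by blast
  then show ?thesis by (simp add: banach_mazur_class_dist_def)
qed

end

theory Submission
  imports Defs
begin

text \<open>
Write \<open>\<delta> = \<pi> / 2N\<close>, \<open>c = cos (\<delta> / 2)\<close> and \<open>d = 1 / c\<close>. From a point at distance \<open>d\<close> from the
origin the tangents to the unit disc touch it at angular distance \<open>\<delta> / 2\<close> on either side. So if
points at distance \<open>d\<close> are placed over some of the \<open>4N\<close> directions \<open>j\<delta>\<close>, the convex hull of these
spikes and the disc still has radius exactly 1 in every direction at angular distance at least
\<open>\<delta> / 2\<close> from all spikes. A set \<open>A\<close> of residues modulo \<open>2N\<close> chooses the spikes symmetrically and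
gives a body \<open>K\<^sub>A\<close> (\<open>spiked_disc\<close>) between the unit disc and the disc of radius \<open>d\<close>. Any two such
bodies are therefore at distance at most \<open>d\<^sup>2\<close>, witnessed by the homothety with factor \<open>d\<close>.

For the lower bound let \<open>K\<^sub>A \<subseteq> T K\<^sub>B \<subseteq> r K\<^sub>A\<close> with \<open>r \<le> d\<^sup>2\<close>. Then \<open>T\<close> distorts lengths by a factor
\<open>1 + O(N\<^sup>-\<^sup>2)\<close> only, so up to an angle that is small against \<open>\<delta>\<close> it acts on directions as a rotation
or a reflection. Let \<open>m(T)\<close> be the mean of \<open>|T x|\<^sup>2\<close> over the unit circle. As \<open>|T x|\<^sup>2 - m(T)\<close> is a
multiple of the cosine of twice the angle, \<open>|T x|\<^sup>2 \<ge> m(T)\<close> on two opposite quarters of the circle,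
that is, for \<open>N\<close> consecutive spike directions. If one spike of \<open>K\<^sub>B\<close> among them is carried to a
direction far from all spikes of \<open>K\<^sub>A\<close>, then its image, of norm at least \<open>d sqrt (m(T))\<close>, lies over
a point where \<open>r K\<^sub>A\<close> has radius \<open>r\<close>; hence \<open>d\<^sup>2 m(T) \<le> r\<^sup>2\<close>
(lemma \<open>mean_square_le_of_misfits\<close>). The same argument for the inverse of \<open>T\<close>, which maps \<open>K\<^sub>A\<close> into
\<open>K\<^sub>B\<close>, gives \<open>d\<^sup>2 m(T\<^sup>-\<^sup>1) \<le> 1\<close>. Since \<open>m(T) m(T\<^sup>-\<^sup>1) \<ge> 1\<close> by the Cauchy--Schwarz inequality
(lemma \<open>mean_square_inverse\<close>), the two bounds multiply to \<open>d\<^sup>2 \<le> r\<close>.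

What is required of \<open>A\<close> and \<open>B\<close> is thus purely combinatorial: for every rotation or reflection and
every quarter of the circle, some spike of one must land far from all spikes of the other, in both
directions (\<open>misfits\<close>). One index \<open>i\<close> gives such a spike if five independent bits have prescribed
values, and every fourth index uses different bits, so a pair of random sets fails a given rotation
and quarter with probability at most \<open>(31/32) ^ (N div 4)\<close>; there are only \<open>8 N\<^sup>2\<close> rotations,
reflections and quarters up to periodicity. The graph of failing pairs is therefore exponentially sparse, and it has
an independent set larger than \<open>1.001 ^ N\<close>, which exceeds \<open>C ^ N\<close>.
\<close>

section \<open>Counting sets without prescribed patterns\<close>

text \<open>
A random subset of \<open>S\<close> shows the pattern \<open>P t\<close> on the block \<open>B t\<close> with probability
\<open>2\<^sup>-\<^sup>m\<close>, independently for disjoint blocks. Peeling off one block at a time turns this into a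
count; the product form avoids division and the subtraction \<open>card S - m * card I\<close>.
\<close>

lemma card_avoiding_patterns:
  assumes "finite I" "finite S"
    and "\<And>t. t \<in> I \<Longrightarrow> B t \<subseteq> S" "\<And>t. t \<in> I \<Longrightarrow> card (B t) = m" "\<And>t. t \<in> I \<Longrightarrow> P t \<subseteq> B t"
    and "disjoint_family_on B I"
  shows "card {X. X \<subseteq> S \<and> (\<forall>t\<in>I. X \<inter> B t \<noteq> P t)} * 2 ^ (m * card I)
      \<le> (2 ^ m - 1) ^ card I * 2 ^ card S"
  using assms
proof (induction I arbitrary: S rule: finite_induct)
  case empty
  then show ?case by (simp add: card_Pow flip: Pow_def)
next
  case (insert a I)
  \<comment> \<open>A set splits into its trace on the block, one of \<open>2 ^ m - 1\<close> subsets, and the rest.\<close>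
  let ?S = "S - B a"
  let ?F = "{X. X \<subseteq> S \<and> (\<forall>t\<in>insert a I. X \<inter> B t \<noteq> P t)}"
  let ?G = "{X. X \<subseteq> ?S \<and> (\<forall>t\<in>I. X \<inter> B t \<noteq> P t)}"
  have Ba: "B a \<subseteq> S" "card (B a) = m" "finite (B a)" "P a \<subseteq> B a"
    using insert.prems(2-4)[of a] finite_subset[OF _ insert.prems(1)] by simp_all
  have disj: "B a \<inter> B t = {}" if "t \<in> I" for t
    using insert.prems(5) insert.hyps(2) that by (auto simp: disjoint_family_on_def)
  have fin: "finite ?G" "finite (Pow (B a) - {P a})"
    using insert.prems(1) Ba(3) by auto
  have "card ?F \<le> card ((Pow (B a) - {P a}) \<times> ?G)"
  proof (rule card_inj_on_le)
    show "inj_on (\<lambda>X. (X \<inter> B a, X - B a)) ?F"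
      by (rule inj_onI) blast
    have "(X - B a) \<inter> B t = X \<inter> B t" if "t \<in> I" for X t
      using disj[OF that] by blast
    then show "(\<lambda>X. (X \<inter> B a, X - B a)) ` ?F \<subseteq> (Pow (B a) - {P a}) \<times> ?G"
      by auto
  qed (use fin in auto)
  also have "\<dots> = (2 ^ m - 1) * card ?G"
    using Ba by (simp add: card_cartesian_product card_Diff_singleton card_Pow)
  finally have F: "card ?F \<le> (2 ^ m - 1) * card ?G" .
  have G: "card ?G * 2 ^ (m * card I) \<le> (2 ^ m - 1) ^ card I * 2 ^ card ?S"
  proof (rule insert.IH)
    show "B t \<subseteq> ?S" if "t \<in> I" for t
      using insert.prems(2)[of t] disj[OF that] that by blast
    show "disjoint_family_on B I"
      using insert.prems(5) by (auto simp: disjoint_family_on_def)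
  qed (use insert.prems in auto)
  have S: "card S = card ?S + m"
    using Ba insert.prems(1) by (metis card_Diff_subset card_mono le_add_diff_inverse2)
  have "card ?F * 2 ^ (m * card (insert a I)) \<le> (2 ^ m - 1) * card ?G * 2 ^ (m * card (insert a I))"
    using F by simp
  also have "\<dots> = (2 ^ m - 1) * 2 ^ m * (card ?G * 2 ^ (m * card I))"
    using insert.hyps by (simp add: power_add)
  also have "\<dots> \<le> (2 ^ m - 1) * 2 ^ m * ((2 ^ m - 1) ^ card I * 2 ^ card ?S)"
    using G by simp
  also have "\<dots> = (2 ^ m - 1) ^ card (insert a I) * 2 ^ card S"
    using insert.hyps by (simp add: S power_add)
  finally show ?case .
qed

section \<open>Independent sets in sparse graphs\<close>

text \<open>
With \<open>n\<close> vertices and \<open>b\<close> ordered edges, at least half of the vertices have degree at most \<open>2b/n\<close>.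
A maximal independent set among these dominates them, so it has at least about \<open>n\<^sup>2 / (2n + 4b)\<close>
elements.
\<close>

lemma large_independent_set:
  fixes R :: "'a \<Rightarrow> 'a \<Rightarrow> bool"
  assumes V: "finite V" "V \<noteq> {}" and sym: "\<And>x y. R x y \<Longrightarrow> R y x"
  obtains I where "I \<subseteq> V" "\<And>x y. x \<in> I \<Longrightarrow> y \<in> I \<Longrightarrow> x \<noteq> y \<Longrightarrow> \<not> R x y"
    "(card V)\<^sup>2 \<le> 2 * card I * (card V + 2 * card {(x, y). x \<in> V \<and> y \<in> V \<and> R x y})"
proof -
  define n where "n = card V"
  define E where "E = {(x, y). x \<in> V \<and> y \<in> V \<and> R x y}"
  define N where "N x = {y \<in> V. R x y}" for x
  define b where "b = card E"
  define H where "H = {x \<in> V. n * card (N x) \<le> 2 * b}"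
  have fin: "finite H" "finite (N x)" for x
    using V(1) by (auto simp: H_def N_def)
  have "E = Sigma V N"
    by (auto simp: E_def N_def)
  then have b: "b = (\<Sum>x\<in>V. card (N x))"
    unfolding b_def using V(1) fin(2) by simp
  have "0 < n"
    using V by (simp add: n_def card_gt_0_iff)
  have "n \<le> 2 * card H"
  proof -
    have "card (V - H) * (2 * b + 1) = (\<Sum>x\<in>V - H. 2 * b + 1)" by simp
    also have "\<dots> \<le> (\<Sum>x\<in>V - H. n * card (N x))"
      by (rule sum_mono) (auto simp: H_def)
    also have "\<dots> \<le> (\<Sum>x\<in>V. n * card (N x))"
      using V(1) by (intro sum_mono2) auto
    also have "\<dots> = n * b"
      by (simp add: b sum_distrib_left)
    finally have *: "card (V - H) * (2 * b + 1) \<le> n * b" .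
    have "2 * card (V - H) \<le> n"
    proof (rule ccontr)
      assume "\<not> ?thesis"
      then have "(n + 1) * (2 * b + 1) \<le> 2 * card (V - H) * (2 * b + 1)"
        by (intro mult_right_mono) auto
      also have "\<dots> \<le> n * (2 * b)" using * by simp
      finally show False by simp
    qed
    moreover have "card V = card (V - H) + card H"
      using V(1) by (metis (no_types, lifting) H_def card_Diff_subset card_mono fin(1) le_add_diff_inverse2 mem_Collect_eq subsetI)
    ultimately show ?thesis by (simp add: n_def)
  qed
  define \<I> where "\<I> = {I. I \<subseteq> H \<and> (\<forall>x\<in>I. \<forall>y\<in>I. x \<noteq> y \<longrightarrow> \<not> R x y)}"
  have "finite \<I>" "{} \<in> \<I>"
    using fin(1) by (auto simp: \<I>_def)
  then obtain I where I: "I \<in> \<I>" and max: "\<And>J. J \<in> \<I> \<Longrightarrow> I \<subseteq> J \<Longrightarrow> I = J"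
    using finite_has_maximal2[of \<I> "{}"] by blast
  have "finite I"
    using I fin(1) by (auto simp: \<I>_def intro: finite_subset)
  have "H \<subseteq> (\<Union>x\<in>I. insert x (N x))"
  proof
    fix x assume x: "x \<in> H"
    show "x \<in> (\<Union>x\<in>I. insert x (N x))"
    proof (rule ccontr)
      assume "x \<notin> (\<Union>x\<in>I. insert x (N x))"
      then have "x \<notin> I" "\<And>y. y \<in> I \<Longrightarrow> \<not> R y x"
        using x by (auto simp: N_def H_def)
      then have "insert x I \<in> \<I>"
        using I x sym unfolding \<I>_def by blast
      with max \<open>x \<notin> I\<close> show False by blast
    qed
  qed
  then have "card H \<le> card (\<Union>x\<in>I. insert x (N x))"
    using fin(2) \<open>finite I\<close> by (intro card_mono) auto
  also have "\<dots> \<le> (\<Sum>x\<in>I. card (insert x (N x)))"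
    using \<open>finite I\<close> by (rule card_UN_le)
  also have "\<dots> \<le> (\<Sum>x\<in>I. 1 + card (N x))"
    by (intro sum_mono) (simp add: card_insert_if fin(2))
  finally have "n * card H \<le> n * (\<Sum>x\<in>I. 1 + card (N x))"
    by simp
  also have "\<dots> = (\<Sum>x\<in>I. n + n * card (N x))"
    by (simp add: sum_distrib_left distrib_left)
  also have "\<dots> \<le> (\<Sum>x\<in>I. n + 2 * b)"
    using I by (intro sum_mono) (auto simp: \<I>_def H_def)
  finally have "n * card H \<le> card I * (n + 2 * b)" by simp
  moreover have "n\<^sup>2 \<le> n * (2 * card H)"
    using \<open>n \<le> 2 * card H\<close> by (simp add: power2_eq_square)
  ultimately have "n\<^sup>2 \<le> 2 * card I * (n + 2 * b)" by simp
  with I show thesis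
    by (intro that[of I]) (auto simp: \<I>_def H_def n_def b_def E_def)
qed


section \<open>Misfitting sets of residues\<close>

text \<open>
An index is carried by \<open>i \<mapsto> k + \<sigma> i\<close>, a rotation or reflection up to rounding, and \<open>q\<close> marks the
quarter \<open>q, \<dots>, q + N - 1\<close> that is searched. The four offsets \<open>e\<close> make up the window that absorbs the
rounding: every index outside it is at distance at least 2 from a landing point between its two
middle elements.
\<close>

definition covered :: "nat \<Rightarrow> int \<Rightarrow> int \<Rightarrow> int \<Rightarrow> int set \<Rightarrow> int set \<Rightarrow> bool" where
  "covered N \<sigma> k q A B \<longleftrightarrow> (\<forall>i\<in>{q..<q + int N}. i mod (2 * int N) \<in> A \<longrightarrow>
     (\<exists>e\<in>{0..<4}. (k + \<sigma> * i + e) mod (2 * int N) \<in> B))"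

definition misfits :: "nat \<Rightarrow> int set \<Rightarrow> int set \<Rightarrow> bool" where
  "misfits N A B \<longleftrightarrow> (\<forall>\<sigma>\<in>{1, -1}. \<forall>k q. \<not> covered N \<sigma> k q A B)"

lemma not_misfits_iff:
  "\<not> misfits N A B \<longleftrightarrow> (\<exists>\<sigma>\<in>{1, -1}. \<exists>k q. covered N \<sigma> k q A B)"
  unfolding misfits_def by blast

text \<open>
This reduces the infinitely many parameters \<open>k\<close> and \<open>q\<close> to \<open>(2N)\<^sup>2\<close>. Shifting \<open>q\<close> by a multiple of
\<open>2N\<close> shifts \<open>i\<close> by it and the window by a multiple of \<open>2N\<close>.
\<close>

lemma covered_mod:
  assumes "covered N \<sigma> k q A B"
  shows "covered N \<sigma> (k mod (2 * int N)) (q mod (2 * int N)) A B"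
  unfolding covered_def
proof (intro ballI impI)
  define n where "n = 2 * int N"
  fix i assume i: "i \<in> {q mod (2 * int N)..<q mod (2 * int N) + int N}" "i mod (2 * int N) \<in> A"
  define i' where "i' = i + n * (q div n)"
  have "q mod n \<le> i" "i < q mod n + int N"
    using i(1) by (simp_all add: n_def)
  with mult_div_mod_eq[of n q] have "q \<le> i'" "i' < q + int N"
    unfolding i'_def by linarith+
  moreover have "i' mod n \<in> A"
    using i(2) by (simp add: i'_def n_def)
  ultimately have "i' \<in> {q..<q + int N}" "i' mod n \<in> A"
    by auto
  then obtain e where e: "e \<in> {0..<4}" "(k + \<sigma> * i' + e) mod n \<in> B"
    using assms unfolding covered_def n_def by blast
  have "k + \<sigma> * i' + e = k mod n + \<sigma> * i + e + n * (k div n + \<sigma> * (q div n))"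
    unfolding i'_def by (simp add: algebra_simps)
  then have "(k + \<sigma> * i' + e) mod n = (k mod n + \<sigma> * i + e) mod n"
    by (simp only: mod_mult_self2)
  with e show "\<exists>e\<in>{0..<4}. (k mod (2 * int N) + \<sigma> * i + e) mod (2 * int N) \<in> B"
    unfolding n_def by metis
qed

lemma mod_eq_imp_eq:
  fixes a b n :: int
  assumes "a mod n = b mod n" "\<bar>a - b\<bar> < n"
  shows "a = b"
proof (rule ccontr)
  assume "a \<noteq> b"
  have "n dvd a - b"
    using assms(1) by (simp add: mod_eq_dvd_iff)
  then have "\<bar>n\<bar> \<le> \<bar>a - b\<bar>"
    using \<open>a \<noteq> b\<close> by (intro dvd_imp_le_int) auto
  with assms(2) show False by simp
qed

text \<open>
The pair is encoded as one subset of a disjoint sum, so that independence within and between the two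
sets is handled alike. Being covered forbids, for each \<open>i\<close>, the pattern "\<open>i\<close> in the first
set, its window disjoint from the second" on five places. Only every fourth \<open>i\<close> is used, because
then the windows are disjoint.
\<close>

lemma card_covered_le:
  fixes N :: nat
  assumes \<sigma>: "\<sigma> = 1 \<or> \<sigma> = -1"
  defines "D \<equiv> {0..<2 * int N}"
  shows "card {(A, B). A \<subseteq> D \<and> B \<subseteq> D \<and> covered N \<sigma> k q A B} * 32 ^ (N div 4)
    \<le> 31 ^ (N div 4) * 16 ^ N"
proof -
  define n where "n = 2 * int N"
  define T where "T = N div 4"
  define i where "i t = q + 4 * int t" for t
  define W where "W t = (\<lambda>e. (k + \<sigma> * i t + e) mod n) ` {0..<4}" for t
  define S where "S = D <+> D"
  define B where "B t = {i t mod n} <+> W t" for t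
  define P where "P t = {i t mod n} <+> ({} :: int set)" for t
  let ?F = "{(A, B). A \<subseteq> D \<and> B \<subseteq> D \<and> covered N \<sigma> k q A B}"
  have T: "4 * int t + 4 \<le> int N" if "t < T" for t
    using that unfolding T_def by linarith
  have "card ?F \<le> card {X. X \<subseteq> S \<and> (\<forall>t\<in>{..<T}. X \<inter> B t \<noteq> P t)}"
  proof (rule card_inj_on_le)
    show "inj_on (\<lambda>(X, Y). X <+> Y) ?F"
      by (rule inj_onI) (auto simp: Plus_def)
    show "finite {X. X \<subseteq> S \<and> (\<forall>t\<in>{..<T}. X \<inter> B t \<noteq> P t)}"
      by (simp add: S_def D_def)
    show "(\<lambda>(X, Y). X <+> Y) ` ?F \<subseteq> {X. X \<subseteq> S \<and> (\<forall>t\<in>{..<T}. X \<inter> B t \<noteq> P t)}"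
    proof (clarsimp, intro conjI ballI notI)
      fix X Y assume XY: "X \<subseteq> D" "Y \<subseteq> D" "covered N \<sigma> k q X Y"
      then show "X <+> Y \<subseteq> S" by (auto simp: S_def)
      fix t assume t: "t \<in> {..<T}" and eq: "(X <+> Y) \<inter> B t = P t"
      have "i t mod n \<in> X" "W t \<inter> Y = {}"
        using eq unfolding B_def P_def by (auto simp: Plus_def)
      moreover have "i t \<in> {q..<q + int N}"
        using T[of t] t by (auto simp: i_def)
      ultimately show False
        using XY(3) unfolding covered_def W_def n_def by blast
    qed
  qed
  moreover have "card {X. X \<subseteq> S \<and> (\<forall>t\<in>{..<T}. X \<inter> B t \<noteq> P t)} * 2 ^ (5 * card {..<T})
      \<le> (2 ^ 5 - 1) ^ card {..<T} * 2 ^ card S"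
  proof (rule card_avoiding_patterns)
    fix t assume "t \<in> {..<T}"
    then have "4 \<le> N" using T[of t] by simp
    then have "0 < n" by (simp add: n_def)
    then show "B t \<subseteq> S"
      by (auto simp: B_def S_def W_def D_def n_def)
    have "inj_on (\<lambda>e. (k + \<sigma> * i t + e) mod n) {0..<4}"
      using \<open>4 \<le> N\<close> by (intro inj_onI) (drule mod_eq_imp_eq, auto simp: n_def)
    then have "card (W t) = 4"
      unfolding W_def by (simp add: card_image)
    then show "card (B t) = 5"
      unfolding B_def by (subst card_Plus) (simp_all add: W_def)
    show "P t \<subseteq> B t" by (auto simp: P_def B_def)
  next
    show "disjoint_family_on B {..<T}"
      unfolding disjoint_family_on_def
    proof (intro ballI impI)
      fix s t assume st: "s \<in> {..<T}" "t \<in> {..<T}" "s \<noteq> t"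
      \<comment> \<open>The range of the indices and offsets stays below the period, so congruent means equal.\<close>
      have near: "\<bar>4 * int s - 4 * int t\<bar> + 4 \<le> int N"
        using T[of s] T[of t] st by auto
      have "i s mod n \<noteq> i t mod n"
        using mod_eq_imp_eq[of "i s" n "i t"] near st by (auto simp: i_def n_def)
      moreover have "(k + \<sigma> * i s + e) mod n \<noteq> (k + \<sigma> * i t + e') mod n"
        if "e \<in> {0..<4}" "e' \<in> {0..<4}" for e e'
      proof
        assume "(k + \<sigma> * i s + e) mod n = (k + \<sigma> * i t + e') mod n"
        moreover have "\<bar>(k + \<sigma> * i s + e) - (k + \<sigma> * i t + e')\<bar> < n"
          using \<sigma> near that by (auto simp: i_def n_def)
        ultimately have "k + \<sigma> * i s + e = k + \<sigma> * i t + e'"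
          by (rule mod_eq_imp_eq)
        with \<sigma> that st(3) show False
          by (auto simp: i_def)
      qed
      ultimately show "B s \<inter> B t = {}"
        by (auto simp: B_def W_def Plus_def)
    qed
  qed (auto simp: S_def D_def)
  moreover have "card S = 4 * N"
    by (simp add: S_def D_def card_Plus)
  ultimately have "card ?F * 2 ^ (5 * T) \<le> (2 ^ 5 - 1) ^ T * 2 ^ (4 * N)"
    by (simp del: power_mult) (meson le_trans mult_le_mono1)
  then show ?thesis
    by (simp add: T_def power_mult)
qed

text \<open>
Union bound over the two orientations and the \<open>(2N)\<^sup>2\<close> pairs of residues \<open>k\<close>, \<open>q\<close>.
\<close>

lemma card_not_misfits_le:
  fixes N :: nat
  assumes "0 < N"
  defines "D \<equiv> {0..<2 * int N}"
  shows "card {(A, B). A \<subseteq> D \<and> B \<subseteq> D \<and> \<not> misfits N A B} * 32 ^ (N div 4)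
    \<le> 8 * N\<^sup>2 * 31 ^ (N div 4) * 16 ^ N"
proof -
  let ?F = "\<lambda>(\<sigma>, k, q). {(A, B). A \<subseteq> D \<and> B \<subseteq> D \<and> covered N \<sigma> k q A B}"
  let ?I = "{1, -1 :: int} \<times> D \<times> D"
  have fin: "finite (?F p)" for p
    by (rule finite_subset[of _ "Pow D \<times> Pow D"]) (auto simp: D_def)
  have "{(A, B). A \<subseteq> D \<and> B \<subseteq> D \<and> \<not> misfits N A B} \<subseteq> (\<Union>p\<in>?I. ?F p)"
  proof clarify
    fix A B assume AB: "A \<subseteq> D" "B \<subseteq> D" "\<not> misfits N A B"
    then obtain \<sigma> k q where "\<sigma> \<in> {1, -1}" and *: "covered N \<sigma> k q A B"
      unfolding not_misfits_iff by blast
    moreover have "k mod (2 * int N) \<in> D" "q mod (2 * int N) \<in> D"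
      using assms(1) by (auto simp: D_def)
    ultimately have "(\<sigma>, k mod (2 * int N), q mod (2 * int N)) \<in> ?I"
      by simp
    then show "(A, B) \<in> (\<Union>p\<in>?I. ?F p)"
      by (rule UN_I) (use AB covered_mod[OF *] in auto)
  qed
  then have "card {(A, B). A \<subseteq> D \<and> B \<subseteq> D \<and> \<not> misfits N A B} \<le> card (\<Union>p\<in>?I. ?F p)"
    by (intro card_mono finite_UN_I fin) (auto simp: D_def)
  also have "\<dots> \<le> (\<Sum>p\<in>?I. card (?F p))"
    by (rule card_UN_le) (simp add: D_def)
  finally have "card {(A, B). A \<subseteq> D \<and> B \<subseteq> D \<and> \<not> misfits N A B} * 32 ^ (N div 4)
      \<le> (\<Sum>p\<in>?I. card (?F p) * 32 ^ (N div 4))"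
    by (simp only: sum_distrib_right[symmetric] mult_le_mono1)
  also have "\<dots> \<le> (\<Sum>p\<in>?I. 31 ^ (N div 4) * 16 ^ N)"
    using card_covered_le[of _ N] by (intro sum_mono) (auto simp: D_def)
  also have "\<dots> = 8 * N\<^sup>2 * 31 ^ (N div 4) * 16 ^ N"
    by (simp add: D_def card_cartesian_product power2_eq_square nat_mult_distrib)
  finally show ?thesis .
qed

text \<open>
The relation of failing in at least one of the two orders is symmetric and holds for at most
twice as many pairs as failing in the given order. Distinct members of an independent set for it
misfit both ways.
\<close>

lemma large_misfit_family:
  assumes "0 < N"
  obtains F where "finite F" "\<And>A B. A \<in> F \<Longrightarrow> B \<in> F \<Longrightarrow> A \<noteq> B \<Longrightarrow> misfits N A B"
    "1 \<le> real (card F) * (2 * (1 / 4) ^ N + 64 * (real N)\<^sup>2 * (31 / 32) ^ (N div 4))"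
proof -
  define D where "D = {0..<2 * int N}"
  define R where "R A B \<longleftrightarrow> \<not> misfits N A B \<or> \<not> misfits N B A" for A B
  define E where "E = {(A, B). A \<subseteq> D \<and> B \<subseteq> D \<and> \<not> misfits N A B}"
  have card_Pow_D: "card (Pow D) = 4 ^ N"
    by (simp add: D_def card_Pow nat_mult_distrib power_mult)
  have "finite E"
    by (rule finite_subset[of _ "Pow D \<times> Pow D"]) (auto simp: D_def E_def)
  obtain F where F: "F \<subseteq> Pow D" "\<And>A B. A \<in> F \<Longrightarrow> B \<in> F \<Longrightarrow> A \<noteq> B \<Longrightarrow> \<not> R A B"
    and le: "(card (Pow D))\<^sup>2 \<le> 2 * card F * (card (Pow D) +
      2 * card {(A, B). A \<in> Pow D \<and> B \<in> Pow D \<and> R A B})"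
    by (rule large_independent_set[of "Pow D" R]) (auto simp: R_def D_def)
  have "{(A, B). A \<in> Pow D \<and> B \<in> Pow D \<and> R A B} \<subseteq> E \<union> prod.swap ` E"
    by (auto simp: E_def R_def image_iff)
  then have "card {(A, B). A \<in> Pow D \<and> B \<in> Pow D \<and> R A B} \<le> card (E \<union> prod.swap ` E)"
    using \<open>finite E\<close> by (intro card_mono) auto
  also have "\<dots> \<le> card E + card (prod.swap ` E)"
    by (rule card_Un_le)
  also have "\<dots> \<le> 2 * card E"
    using card_image_le[OF \<open>finite E\<close>, of prod.swap] by simp
  finally have "2 * card F * (card (Pow D) + 2 * card {(A, B). A \<in> Pow D \<and> B \<in> Pow D \<and> R A B})
      \<le> 2 * card F * (card (Pow D) + 2 * (2 * card E))"
    by (intro mult_le_mono2 add_le_mono) auto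
  with le have "(card (Pow D))\<^sup>2 \<le> 2 * card F * (card (Pow D) + 2 * (2 * card E))"
    by (rule le_trans)
  then have "(4 ^ N)\<^sup>2 \<le> 2 * card F * (4 ^ N + 4 * card E)"
    by (simp add: card_Pow_D)
  then have "real ((4 ^ N)\<^sup>2) \<le> real (2 * card F * (4 ^ N + 4 * card E))"
    by (simp only: of_nat_le_iff)
  moreover have "(4 ^ N)\<^sup>2 = (16 :: real) ^ N"
    by (simp add: power2_eq_square flip: power_mult_distrib)
  ultimately have *: "16 ^ N \<le> 2 * real (card F) * (4 ^ N + 4 * real (card E))"
    by simp
  have "real (card E * 32 ^ (N div 4)) \<le> real (8 * N\<^sup>2 * 31 ^ (N div 4) * 16 ^ N)"
    using card_not_misfits_le[OF assms] unfolding E_def D_def of_nat_le_iff by simp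
  then have "real (card E) \<le> 8 * (real N)\<^sup>2 * (31 / 32) ^ (N div 4) * 16 ^ N"
    by (simp add: field_simps power_divide)
  then have "2 * real (card F) * (4 ^ N + 4 * real (card E))
      \<le> 2 * real (card F) * (4 ^ N + 4 * (8 * (real N)\<^sup>2 * (31 / 32) ^ (N div 4) * 16 ^ N))"
    by (intro mult_left_mono add_left_mono) auto
  with * have "16 ^ N \<le> 2 * real (card F) * (4 ^ N + 4 * (8 * (real N)\<^sup>2 * (31 / 32) ^ (N div 4) * 16 ^ N))"
    by linarith
  also have "(4 :: real) ^ N = 16 ^ N * (1 / 4) ^ N"
    by (simp flip: power_mult_distrib)
  finally have "16 ^ N * 1 \<le> 16 ^ N *
      (real (card F) * (2 * (1 / 4) ^ N + 64 * (real N)\<^sup>2 * (31 / 32) ^ (N div 4)))"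
    by (simp only: algebra_simps)
  then have "1 \<le> real (card F) * (2 * (1 / 4) ^ N + 64 * (real N)\<^sup>2 * (31 / 32) ^ (N div 4))"
    by (subst (asm) mult_le_cancel_left_pos) auto
  moreover have "finite F"
    using F(1) by (rule finite_subset) (simp add: D_def)
  ultimately show thesis
    using F(2) by (intro that) (auto simp: R_def)
qed

text \<open>
This holds because \<open>1.001\<^sup>4 \<cdot> 31/32 < 1\<close>. The proof uses \<open>31/32 \<le> 0.995\<^sup>4\<close> and
\<open>1.001 \<cdot> 0.995 \<le> 0.998\<^sup>2\<close>; the square makes \<open>N\<^sup>2\<close> part of the null sequence \<open>(N \<cdot> 0.998 ^ N)\<^sup>2\<close>.
\<close>

lemma eventually_exponential_wins:
  "\<forall>\<^sub>F N in sequentially.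
     1.001 ^ N * (2 * (1 / 4) ^ N + 64 * (real N)\<^sup>2 * (31 / 32) ^ (N div 4)) < 1"
proof -
  have bound: "1.001 ^ N * (2 * (1 / 4) ^ N + 64 * (real N)\<^sup>2 * (31 / 32) ^ (N div 4))
      \<le> 2 * (1 / 2) ^ N + 128 * (real N * 0.998 ^ N)\<^sup>2" for N :: nat
  proof -
    have "(31 / 32 :: real) ^ (N div 4) \<le> (0.995 ^ 4) ^ (N div 4)"
      by (intro power_mono) (simp_all add: eval_nat_numeral)
    also have "\<dots> = 0.995 ^ (4 * (N div 4))"
      by (rule power_mult[symmetric])
    also have "\<dots> \<le> 2 * 0.995 ^ N"
    proof -
      have split: "0.995 ^ N = (0.995 :: real) ^ (4 * (N div 4)) * 0.995 ^ (N mod 4)"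
        by (simp flip: power_add)
      have "(0.995 :: real) ^ 3 \<le> 0.995 ^ (N mod 4)"
        by (rule power_decreasing) auto
      moreover have "1 / 2 \<le> (0.995 :: real) ^ 3"
        by (simp add: power3_eq_cube)
      ultimately have "1 / 2 \<le> (0.995 :: real) ^ (N mod 4)"
        by (rule order_trans[rotated])
      then have "(0.995 :: real) ^ (4 * (N div 4)) * (1 / 2) \<le> 0.995 ^ (4 * (N div 4)) * 0.995 ^ (N mod 4)"
        by (rule mult_left_mono) simp
      with split show ?thesis by linarith
    qed
    finally have "1.001 ^ N * (2 * (1 / 4) ^ N + 64 * (real N)\<^sup>2 * (31 / 32) ^ (N div 4))
        \<le> 1.001 ^ N * (2 * (1 / 4) ^ N + 64 * (real N)\<^sup>2 * (2 * 0.995 ^ N))"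
      by (intro mult_left_mono add_left_mono) auto
    also have "\<dots> = 2 * (1.001 * (1 / 4)) ^ N + 128 * (real N)\<^sup>2 * (1.001 * 0.995) ^ N"
      by (simp only: power_mult_distrib) (simp add: algebra_simps)
    also have "\<dots> \<le> 2 * (1 / 2) ^ N + 128 * (real N)\<^sup>2 * (0.998\<^sup>2) ^ N"
      by (intro add_mono mult_left_mono power_mono) (simp_all add: power2_eq_square)
    also have "((0.998 :: real)\<^sup>2) ^ N = (0.998 ^ N)\<^sup>2"
      by (simp only: power_mult[symmetric] mult.commute)
    finally show ?thesis
      by (simp add: power_mult_distrib mult.assoc)
  qed
  have "(\<lambda>N. real N * 0.998 ^ N) \<longlonglongrightarrow> 0"
    by (rule powser_times_n_limit_0) simp
  then have "(\<lambda>N. 2 * (1 / 2) ^ N + 128 * (real N * 0.998 ^ N)\<^sup>2) \<longlonglongrightarrow> 2 * 0 + 128 * 0\<^sup>2"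
    by (intro tendsto_intros LIMSEQ_realpow_zero) auto
  then have "\<forall>\<^sub>F N in sequentially. 2 * (1 / 2) ^ N + 128 * (real N * 0.998 ^ N)\<^sup>2 < 1"
    by (rule order_tendstoD) simp
  then show ?thesis
    by (rule eventually_mono) (use bound in \<open>fastforce intro: le_less_trans\<close>)
qed


section \<open>Linear maps of the plane in polar form\<close>

definition dir :: "real \<Rightarrow> real ^ 2" where
  "dir t = vector [cos t, sin t]"

lemma inner_dir: "dir s \<bullet> dir t = cos (s - t)"
  by (simp add: dir_def inner_vec_def sum_2 cos_diff)

lemma norm_dir [simp]: "norm (dir t) = 1"
  by (simp add: norm_eq_sqrt_inner inner_dir)

lemma dir_add_pi: "dir (t + pi) = - dir t"
  by (simp add: dir_def vec_eq_iff forall_2)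

lemma dir_add_2pi: "dir (t + 2 * pi * of_int n) = dir t"
  by (simp add: dir_def vec_eq_iff forall_2 cos_add sin_add cos_int_2pin sin_int_2pin)

lemma dir_eq_combination: "dir t = cos t *\<^sub>R dir 0 + sin t *\<^sub>R dir (pi / 2)"
  by (simp add: dir_def vec_eq_iff forall_2)

lemma plane_eq_combination: "x = x $ 1 *\<^sub>R dir 0 + x $ 2 *\<^sub>R dir (pi / 2)"
  by (simp add: dir_def vec_eq_iff forall_2)

lemma polar_nonneg:
  fixes x y :: real
  obtains r t where "0 \<le> r" "x = r * cos t" "y = r * sin t"
proof -
  obtain r t where rt: "x = r * cos t" "y = r * sin t"
    using polar_Ex[of x y] by blast
  show thesis
  proof (cases "0 \<le> r")
    case True
    then show ?thesis using that rt by blast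
  next
    case False
    then show ?thesis using that[of "- r" "t + pi"] rt by simp
  qed
qed

lemma plane_polar:
  obtains r t where "0 \<le> r" "x = r *\<^sub>R dir t"
proof -
  obtain r t where "0 \<le> r" "x $ 1 = r * cos t" "x $ 2 = r * sin t"
    by (rule polar_nonneg)
  then show thesis
    by (intro that[of r t]) (simp_all add: dir_def vec_eq_iff forall_2)
qed

text \<open>
In complex notation every real-linear map is \<open>z \<mapsto> \<alpha> z + \<beta> cnj z\<close>, a scaled rotation plus a scaled
reflection, with \<open>p\<close> and \<open>q\<close> the larger and the smaller of the two moduli. The sign \<open>\<sigma>\<close> tells
which of them dominates, so it is the orientation if the map is invertible. The singular values are \<open>p + q\<close> and \<open>p - q\<close>.
\<close>

lemma linear_circular_decomposition:
  fixes T :: "real ^ 2 \<Rightarrow> real ^ 2"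
  assumes "linear T"
  obtains p q \<psi> \<omega> \<sigma> where "0 \<le> q" "q \<le> p" "\<sigma> = 1 \<or> \<sigma> = (-1 :: int)"
    "\<And>t. T (dir t) = p *\<^sub>R dir (\<psi> + \<sigma> * t) + q *\<^sub>R dir (\<omega> - \<sigma> * t)"
proof -
  define x y where "x = T (dir 0)" and "y = T (dir (pi / 2))"
  obtain p \<psi> where p: "0 \<le> p" "(x $ 1 + y $ 2) / 2 = p * cos \<psi>" "(x $ 2 - y $ 1) / 2 = p * sin \<psi>"
    by (rule polar_nonneg)
  obtain q \<omega> where q: "0 \<le> q" "(x $ 1 - y $ 2) / 2 = q * cos \<omega>" "(x $ 2 + y $ 1) / 2 = q * sin \<omega>"
    by (rule polar_nonneg)
  have coords: "x $ 1 = p * cos \<psi> + q * cos \<omega>" "y $ 2 = p * cos \<psi> - q * cos \<omega>"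
    "x $ 2 = p * sin \<psi> + q * sin \<omega>" "y $ 1 = q * sin \<omega> - p * sin \<psi>"
    using p q by (simp_all add: field_simps)
  have T: "T (dir t) = p *\<^sub>R dir (\<psi> + t) + q *\<^sub>R dir (\<omega> - t)" for t
  proof -
    have "T (dir t) = cos t *\<^sub>R x + sin t *\<^sub>R y"
      by (subst dir_eq_combination)
        (simp add: x_def y_def linear_add[OF assms] linear_scale[OF assms])
    also have "\<dots> = p *\<^sub>R dir (\<psi> + t) + q *\<^sub>R dir (\<omega> - t)"
      by (simp add: vec_eq_iff forall_2 coords dir_def cos_add sin_add cos_diff sin_diff algebra_simps)
    finally show ?thesis .
  qed
  show thesis
  proof (cases "q \<le> p")
    case True
    then show ?thesis using that[of q p 1 \<psi> \<omega>] T q(1) by simp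
  next
    case False
    then show ?thesis using that[of p q "-1" \<omega> \<psi>] T p(1) by (simp add: add.commute)
  qed
qed

lemma norm_circular_sum:
  "(norm (p *\<^sub>R dir s + q *\<^sub>R dir t))\<^sup>2 = p\<^sup>2 + q\<^sup>2 + 2 * p * q * cos (s - t)"
proof -
  have "cos (t - s) = cos (s - t)"
    by (metis cos_minus minus_diff_eq)
  then show ?thesis
    unfolding power2_norm_eq_inner
    by (simp add: inner_add_left inner_add_right inner_dir power2_eq_square algebra_simps)
qed

text \<open>
Half the squared Hilbert--Schmidt norm, which is the mean of the squared norm of \<open>T x\<close> over the unit
circle. Two orthogonal directions suffice for the mean of a quadratic form.
\<close>

definition mean_square :: "(real ^ 2 \<Rightarrow> real ^ 2) \<Rightarrow> real" where
  "mean_square T = ((norm (T (dir 0)))\<^sup>2 + (norm (T (dir (pi / 2))))\<^sup>2) / 2"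

lemma mean_square_circular:
  assumes "\<And>t. T (dir t) = p *\<^sub>R dir (\<psi> + of_int \<sigma> * t) + q *\<^sub>R dir (\<omega> - of_int \<sigma> * t)"
    and "\<sigma> = 1 \<or> \<sigma> = -1"
  shows "mean_square T = p\<^sup>2 + q\<^sup>2"
proof -
  have "cos (\<psi> + of_int \<sigma> * (pi / 2) - (\<omega> - of_int \<sigma> * (pi / 2))) = - cos (\<psi> - \<omega>)"
  proof -
    have "\<psi> + of_int \<sigma> * (pi / 2) - (\<omega> - of_int \<sigma> * (pi / 2)) = (\<psi> - \<omega>) + of_int \<sigma> * pi"
      by simp
    then show ?thesis
      using assms(2) by (auto simp: cos_add cos_diff)
  qed
  then show ?thesis
    by (simp add: mean_square_def assms(1) norm_circular_sum)
qed

text \<open>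
The trace of the identity, which is 2, is the Hilbert--Schmidt inner product of \<open>T\<close> and the
transpose of \<open>S\<close>; the Cauchy--Schwarz inequality bounds it by their norms.
\<close>

lemma mean_square_inverse:
  fixes S T :: "real ^ 2 \<Rightarrow> real ^ 2"
  assumes "linear S" and inv: "\<And>x. S (T x) = x"
  shows "1 \<le> mean_square T * mean_square S"
proof -
  define a b where "a = T (dir 0)" and "b = T (dir (pi / 2))"
  define u v where "u = S (dir 0)" and "v = S (dir (pi / 2))"
  have S: "S x = x $ 1 *\<^sub>R u + x $ 2 *\<^sub>R v" for x
    by (subst plane_eq_combination) (simp add: u_def v_def linear_add linear_scale assms)
  have "S a = dir 0" "S b = dir (pi / 2)"
    by (simp_all add: a_def b_def inv)
  then have *: "a $ 1 * u $ 1 + a $ 2 * v $ 1 = 1" "b $ 1 * u $ 2 + b $ 2 * v $ 2 = 1"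
    unfolding S by (simp_all add: vec_eq_iff forall_2 dir_def)
  \<comment> \<open>The matrix of \<open>T\<close> and the transposed matrix of \<open>S\<close>, as elements of one inner product space.\<close>
  define x y where "x = ((vector [a $ 1, a $ 2] :: real ^ 2), (vector [b $ 1, b $ 2] :: real ^ 2))"
    and "y = ((vector [u $ 1, v $ 1] :: real ^ 2), (vector [u $ 2, v $ 2] :: real ^ 2))"
  have "x \<bullet> y = 2"
    using * by (simp add: x_def y_def inner_vec_def sum_2)
  moreover have "x \<bullet> x = 2 * mean_square T"
    by (simp add: x_def mean_square_def inner_vec_def sum_2 a_def b_def power2_norm_eq_inner)
  moreover have "y \<bullet> y = 2 * mean_square S"
    by (simp add: y_def mean_square_def inner_vec_def sum_2 u_def v_def power2_norm_eq_inner)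
  ultimately show ?thesis
    using Cauchy_Schwarz_ineq[of x y] by simp
qed

section \<open>Discs with spikes\<close>

text \<open>
There are \<open>4N\<close> directions but \<open>A\<close> is read modulo \<open>2N\<close>: the direction \<open>j + 2N\<close> is opposite to \<open>j\<close>,
so the body is symmetric.
\<close>

definition spiked_disc :: "nat \<Rightarrow> int set \<Rightarrow> (real ^ 2) set" where
  "spiked_disc N A = convex hull (cball 0 1 \<union>
     {(1 / cos (pi / (4 * N))) *\<^sub>R dir (of_int j * pi / (2 * N)) | j. j mod (2 * int N) \<in> A})"

lemma cos_spike_bound:
  assumes "N \<ge> 2"
  shows "0.9 \<le> cos (pi / (4 * real N))" "cos (pi / (4 * real N)) < 1"
proof -
  let ?x = "pi / (4 * real N)"
  have x: "0 < ?x" "?x \<le> pi / 8"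
    using assms by (auto simp: field_simps)
  have "?x \<le> 0.4"
    using x(2) pi_less_4 pi_approx by simp
  then have "?x\<^sup>2 \<le> 0.4\<^sup>2"
    using x(1) by (intro power_mono) auto
  moreover have "1 - ?x\<^sup>2 / 2 \<le> cos ?x"
  proof -
    have "(sin (?x / 2))\<^sup>2 \<le> (?x / 2)\<^sup>2"
      using abs_sin_x_le_abs_x[of "?x / 2"] by (simp only: abs_le_square_iff)
    then show ?thesis
      using cos_double_sin[of "?x / 2"] by (simp add: power2_eq_square)
  qed
  ultimately show "0.9 \<le> cos ?x"
    by (simp add: power2_eq_square)
  have "cos ?x < cos 0"
    using x pi_gt_zero by (intro cos_monotone_0_pi) auto
  then show "cos ?x < 1" by simp
qed

lemma dir_spike_periodic:
  fixes j :: int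
  assumes "N > 0"
  shows "dir (of_int (j mod (4 * int N)) * pi / (2 * N)) = dir (of_int j * pi / (2 * N))"
proof -
  have "of_int j = of_int (j mod (4 * int N)) + 4 * real N * of_int (j div (4 * int N))"
    by (metis (no_types, opaque_lifting) add.commute mult_div_mod_eq of_int_add of_int_mult
        of_int_numeral of_int_of_nat_eq)
  then have "of_int j * pi / (2 * N) =
      of_int (j mod (4 * int N)) * pi / (2 * N) + 2 * pi * of_int (j div (4 * int N))"
    using assms by (simp add: field_simps)
  then show ?thesis
    by (simp only: dir_add_2pi)
qed

lemma cball_subset_spiked_disc: "cball 0 1 \<subseteq> spiked_disc N A"
  unfolding spiked_disc_def by (meson hull_subset le_sup_iff)

lemma spike_in_spiked_disc:
  "j mod (2 * int N) \<in> A \<Longrightarrow>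
    (1 / cos (pi / (4 * N))) *\<^sub>R dir (of_int j * pi / (2 * N)) \<in> spiked_disc N A"
  unfolding spiked_disc_def by (rule hull_inc) blast

lemma spiked_disc_subset_cball:
  assumes "N \<ge> 2"
  shows "spiked_disc N A \<subseteq> cball 0 (1 / cos (pi / (4 * N)))"
proof -
  have "1 \<le> 1 / cos (pi / (4 * N))"
    using cos_spike_bound[OF assms] by (simp add: field_simps)
  then show ?thesis
    unfolding spiked_disc_def by (intro hull_minimal) (auto simp: dist_norm)
qed

lemma symmetric_convex_body_spiked_disc:
  assumes "N > 0"
  shows "symmetric_convex_body (spiked_disc N A)"
proof -
  define f where "f j = (1 / cos (pi / (4 * N))) *\<^sub>R dir (of_int j * pi / (2 * N))" for j :: int
  define P where "P = {f j | j. j mod (2 * int N) \<in> A}"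
  have K: "spiked_disc N A = convex hull (cball 0 1 \<union> P)"
    by (simp add: spiked_disc_def P_def f_def)
  have "f j = f (j mod (4 * int N))" for j
    using dir_spike_periodic[OF assms] by (simp add: f_def)
  then have "P \<subseteq> f ` {0..<4 * int N}"
    unfolding P_def using assms by fastforce
  then have "finite P"
    by (rule finite_subset) simp
  then have "compact (spiked_disc N A)"
    unfolding K by (intro compact_convex_hull compact_Un compact_cball finite_imp_compact)
  moreover have "interior (spiked_disc N A) \<noteq> {}"
    using interior_mono[OF cball_subset_spiked_disc[of N A]] by auto
  moreover have "spiked_disc N A = uminus ` spiked_disc N A"
  proof -
    have neg: "- f j = f (j + 2 * int N)" for j
    proof -
      have "of_int (j + 2 * int N) * pi / (2 * N) = of_int j * pi / (2 * N) + pi"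
        using assms by (simp add: field_simps)
      then show ?thesis
        by (simp only: f_def dir_add_pi scaleR_minus_right)
    qed
    have "uminus ` P \<subseteq> P"
      unfolding P_def by (auto simp: neg)
    then have "uminus ` (cball 0 1 \<union> P) \<subseteq> cball 0 1 \<union> P"
      by auto
    from image_mono[OF this, of uminus] this
    have "uminus ` (cball 0 1 \<union> P) = cball 0 1 \<union> P"
      by (intro subset_antisym) (simp_all only: image_image minus_minus image_ident)
    then show ?thesis
      unfolding K using convex_hull_linear_image[of uminus "cball 0 1 \<union> P"]
      by (simp add: linear_uminus)
  qed
  ultimately show ?thesis
    unfolding symmetric_convex_body_def by (simp add: K)
qed


text \<open>
In a direction at angular distance at least \<open>\<pi> / 4N\<close> from all spikes, the spikes do not
rise above the tangent of the unit circle, so this tangent supports the whole body.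
\<close>

lemma spiked_disc_halfplane:
  assumes "\<And>j. j mod (2 * int N) \<in> A \<Longrightarrow>
      u \<bullet> dir (of_int j * pi / (2 * N)) \<le> cos (pi / (4 * N)) * norm u"
    and "0 < cos (pi / (4 * N))" and "x \<in> spiked_disc N A"
  shows "u \<bullet> x \<le> norm u"
proof -
  have "spiked_disc N A \<subseteq> {x. u \<bullet> x \<le> norm u}"
    unfolding spiked_disc_def
  proof (rule hull_minimal)
    have "u \<bullet> x \<le> norm u" if "norm x \<le> 1" for x
      using norm_cauchy_schwarz[of u x] mult_left_mono[OF that, of "norm u"] by simp
    moreover have "u \<bullet> ((1 / cos (pi / (4 * N))) *\<^sub>R dir (of_int j * pi / (2 * N))) \<le> norm u"
      if "j mod (2 * int N) \<in> A" for j
      using assms(1)[OF that] assms(2) by (simp add: field_simps)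
    ultimately show "cball 0 1 \<union> {(1 / cos (pi / (4 * N))) *\<^sub>R dir (of_int j * pi / (2 * N)) | j.
        j mod (2 * int N) \<in> A} \<subseteq> {x. u \<bullet> x \<le> norm u}"
      by auto
  qed (rule convex_halfspace_le)
  with assms(3) show ?thesis by blast
qed

section \<open>Spikes that protrude under a linear map\<close>

lemma cos_near_one_imp_near_period:
  assumes "N \<ge> 2" and "cos (2 * (pi / (2 * real N))) < cos (x * (pi / (2 * real N)))"
  obtains t :: int where "\<bar>x - 4 * real N * t\<bar> < 2"
proof -
  let ?\<delta> = "pi / (2 * real N)"
  define t where "t = round (x / (4 * real N))"
  define y where "y = x - 4 * real N * t"
  have "\<bar>y\<bar> = 4 * real N * \<bar>x / (4 * real N) - t\<bar>"
    using assms(1) by (simp add: y_def field_simps abs_mult flip: abs_mult_pos)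
  also have "\<dots> \<le> 4 * real N * (1 / 2)"
    using of_int_round_abs_le[of "x / (4 * real N)"]
    by (intro mult_left_mono) (simp_all add: t_def abs_minus_commute)
  finally have y: "\<bar>y\<bar> \<le> 2 * real N" by simp
  have "x * ?\<delta> = y * ?\<delta> + 2 * pi * t"
    using assms(1) by (simp add: y_def field_simps)
  then have "cos (x * ?\<delta>) = cos (y * ?\<delta>)"
    by (simp only: cos_add cos_int_2pin sin_int_2pin)
  also have "\<dots> = cos (\<bar>y\<bar> * ?\<delta>)"
    using assms(1) cos_abs_real[of "y * ?\<delta>"] by (simp add: abs_mult)
  finally have less: "cos (2 * ?\<delta>) < cos (\<bar>y\<bar> * ?\<delta>)"
    using assms(2) by simp
  have "\<bar>y\<bar> < 2"
  proof (rule ccontr)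
    assume "\<not> \<bar>y\<bar> < 2"
    then have "2 * ?\<delta> \<le> \<bar>y\<bar> * ?\<delta>"
      by (intro mult_right_mono) auto
    moreover have "\<bar>y\<bar> * ?\<delta> \<le> 2 * real N * ?\<delta>"
      using y by (intro mult_right_mono) auto
    moreover have "2 * real N * ?\<delta> = pi"
      using assms(1) by simp
    ultimately have "cos (\<bar>y\<bar> * ?\<delta>) \<le> cos (2 * ?\<delta>)"
      by (intro cos_monotone_0_pi_le) auto
    with less show False by simp
  qed
  then show thesis using that by (simp add: y_def)
qed

text \<open>
Here \<open>\<alpha> = \<pi> / 4N\<close> is half the angle between neighbouring spike directions. The rotation part of a
linear map leaves an angle of at least \<open>4\<alpha>\<close> to every spike, and the conclusion says that the
reflection part cannot reduce it below \<open>\<alpha>\<close>. The hypothesis bounds the ratio of the singular values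
by \<open>1 / c\<^sup>6\<close>. With \<open>c = 1 - \<epsilon>\<close> this gives \<open>q/p\<close> up to about \<open>3\<epsilon>\<close>, whereas
\<open>2 q \<le> p (c - cos (4 * \<alpha>))\<close>, with right-hand side about \<open>15 \<epsilon> p\<close>, is enough.
\<close>

lemma distortion_bound:
  assumes c: "0.9 \<le> c" "c < (1 :: real)" "c = cos \<alpha>"
    and pq: "c ^ 6 * (p + q) \<le> p - q" "0 \<le> q" "0 \<le> p"
  shows "p * cos (4 * \<alpha>) + q \<le> c * (p - q)"
proof -
  have "cos (4 * \<alpha>) = 2 * (cos (2 * \<alpha>))\<^sup>2 - 1"
    using cos_double_cos[of "2 * \<alpha>"] by simp
  then have cos4: "cos (4 * \<alpha>) = 8 * c ^ 4 - 8 * c\<^sup>2 + 1"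
    unfolding cos_double_cos[of \<alpha>] c(3)[symmetric] by (simp add: power2_eq_square power4_eq_xxxx algebra_simps)
  \<comment> \<open>The inequality \<open>1 - c ^ 6 \<le> c ^ 3 * (c - cos (4 * \<alpha>))\<close>, divided by the common factor \<open>1 - c\<close>.\<close>
  have "1 + c + c\<^sup>2 + c ^ 3 + c ^ 4 + c ^ 5 \<le> 6"
    using c power_le_one[of c 2] power_le_one[of c 3] power_le_one[of c 4] power_le_one[of c 5]
    by linarith
  also have "6 \<le> 0.729 * (8 * 0.81 * 1.9 - 1 :: real)" by simp
  also have "\<dots> \<le> c ^ 3 * (8 * c\<^sup>2 * (1 + c) - 1)"
  proof -
    have c2: "0.81 \<le> c\<^sup>2" and c3: "0.729 \<le> c ^ 3"
      using power_mono[OF c(1), of 2] power_mono[OF c(1), of 3] by (simp_all add: power_divide)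
    have "8 * 0.81 * 1.9 \<le> 8 * c\<^sup>2 * (1 + c)"
      using c2 c(1) by (intro mult_mono) auto
    with c3 c(1) show ?thesis by (intro mult_mono) auto
  qed
  finally have "(1 - c) * (1 + c + c\<^sup>2 + c ^ 3 + c ^ 4 + c ^ 5) \<le> (1 - c) * (c ^ 3 * (8 * c\<^sup>2 * (1 + c) - 1))"
    using c(2) by (intro mult_left_mono) auto
  also have "(1 - c) * (1 + c + c\<^sup>2 + c ^ 3 + c ^ 4 + c ^ 5) = 1 - c ^ 6"
    by (simp add: algebra_simps eval_nat_numeral)
  also have "(1 - c) * (c ^ 3 * (8 * c\<^sup>2 * (1 + c) - 1)) = c ^ 3 * (c - cos (4 * \<alpha>))"
    unfolding cos4 by (simp add: algebra_simps eval_nat_numeral)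
  finally have gap: "1 - c ^ 6 \<le> c ^ 3 * (c - cos (4 * \<alpha>))" .
  have "q * (2 * c ^ 3) \<le> q * (1 + c ^ 6)"
  proof (rule mult_left_mono[OF _ pq(2)])
    have "0 \<le> (1 - c ^ 3)\<^sup>2" by simp
    then show "2 * c ^ 3 \<le> 1 + c ^ 6"
      by (simp add: power2_diff flip: power_mult)
  qed
  also have "\<dots> \<le> p * (1 - c ^ 6)"
    using pq(1) by (simp add: algebra_simps)
  also have "\<dots> \<le> p * (c ^ 3 * (c - cos (4 * \<alpha>)))"
    using gap pq(3) by (rule mult_left_mono)
  finally have "c ^ 3 * (2 * q) \<le> c ^ 3 * (p * (c - cos (4 * \<alpha>)))"
    by (simp add: mult.commute mult.left_commute)
  then have "2 * q \<le> p * (c - cos (4 * \<alpha>))"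
    using c(1) by simp
  moreover have "q * (1 + c) \<le> 2 * q"
    using mult_right_mono[of c 1 q] c(2) pq(2) by (simp add: algebra_simps)
  ultimately show ?thesis by (simp add: algebra_simps)
qed


text \<open>
The two summands are parallel for some direction and antiparallel for some other, so the norm
attains both \<open>p + q\<close> and \<open>p - q\<close>.
\<close>

lemma circular_sum_bounds:
  fixes T :: "real ^ 2 \<Rightarrow> real ^ 2"
  assumes T: "\<And>t. T (dir t) = p *\<^sub>R dir (\<psi> + of_int \<sigma> * t) + q *\<^sub>R dir (\<omega> - of_int \<sigma> * t)"
    and \<sigma>: "\<sigma> = 1 \<or> \<sigma> = -1" and pq: "0 \<le> q" "q \<le> p"
    and upper: "\<And>t. norm (T (dir t)) \<le> u" and lower: "\<And>t. l \<le> norm (T (dir t))"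
  shows "p + q \<le> u" "l \<le> p - q"
proof -
  have norm: "(norm (T (dir t)))\<^sup>2 = p\<^sup>2 + q\<^sup>2 + 2 * p * q * cos ((\<psi> - \<omega>) + of_int \<sigma> * (2 * t))" for t
    unfolding T norm_circular_sum by (simp add: algebra_simps)
  have "(norm (T (dir (of_int \<sigma> * (\<omega> - \<psi>) / 2))))\<^sup>2 = (p + q)\<^sup>2"
    unfolding norm using \<sigma> by (auto simp: power2_eq_square algebra_simps diff_divide_distrib add_divide_distrib)
  then have "norm (T (dir (of_int \<sigma> * (\<omega> - \<psi>) / 2))) = p + q"
    by (rule power2_eq_imp_eq) (use pq in auto)
  then show "p + q \<le> u"
    using upper[of "of_int \<sigma> * (\<omega> - \<psi>) / 2"] by simp
  have "(norm (T (dir (of_int \<sigma> * (\<omega> - \<psi> + pi) / 2))))\<^sup>2 = (p - q)\<^sup>2"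
    unfolding norm using \<sigma> by (auto simp: power2_eq_square algebra_simps diff_divide_distrib add_divide_distrib)
  then have "norm (T (dir (of_int \<sigma> * (\<omega> - \<psi> + pi) / 2))) = p - q"
    by (rule power2_eq_imp_eq) (use pq in auto)
  then show "l \<le> p - q"
    using lower[of "of_int \<sigma> * (\<omega> - \<psi> + pi) / 2"] by simp
qed

text \<open>
The quarter of the circle on which \<open>T\<close> stretches at least by its quadratic mean contains \<open>N\<close>
consecutive spike directions of the first body. One of these spikes is carried to a direction in
which the second body has radius 1, and comparing radii there bounds the mean. The exponent 3 in
the distortion is what two bodies within distance \<open>1 / c\<^sup>2\<close>, each lying between discs of
ratio \<open>1 / c\<close>, impose on a map between them.
\<close>

lemma mean_square_le_of_misfits:
  fixes T :: "real ^ 2 \<Rightarrow> real ^ 2"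
  defines "c \<equiv> \<lambda>N. cos (pi / (4 * real N))"
  assumes N: "N \<ge> 2" and misfits: "misfits N A B" and "linear T"
    and upper: "\<And>x. norm (T x) \<le> norm x / c N ^ 3"
    and lower: "\<And>x. norm x \<le> norm (T x) / c N ^ 3"
    and s: "0 < s" "T ` spiked_disc N A \<subseteq> (*\<^sub>R) s ` spiked_disc N B"
  shows "mean_square T \<le> s\<^sup>2 * (c N)\<^sup>2"
proof -
  let ?c = "c N"
  define \<delta> where "\<delta> = pi / (2 * real N)"
  have \<delta>: "0 < \<delta>" and N\<delta>: "real N * (2 * \<delta>) = pi"
    using N by (simp_all add: \<delta>_def)
  have c: "0.9 \<le> ?c" "?c < 1"
    using cos_spike_bound[OF N] by (simp_all add: c_def)
  then have c0: "0 < ?c" by simp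
  obtain p q \<psi> \<omega> \<sigma> where pq: "0 \<le> q" "q \<le> p" and \<sigma>: "\<sigma> = 1 \<or> \<sigma> = (-1 :: int)"
    and T: "\<And>t. T (dir t) = p *\<^sub>R dir (\<psi> + of_int \<sigma> * t) + q *\<^sub>R dir (\<omega> - of_int \<sigma> * t)"
    using linear_circular_decomposition[OF \<open>linear T\<close>] by metis
  have pq_bounds: "p + q \<le> 1 / ?c ^ 3" "?c ^ 3 \<le> p - q"
    using circular_sum_bounds[OF T \<sigma> pq, of "1 / ?c ^ 3" "?c ^ 3"] upper[of "dir _"] lower[of "dir _"] c0
    by (auto simp: field_simps)
  have distort: "p * cos (2 * \<delta>) + q \<le> ?c * (p - q)"
  proof -
    have "?c ^ 6 * (p + q) \<le> ?c ^ 6 * (1 / ?c ^ 3)"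
      using pq_bounds(1) c0 by (intro mult_left_mono) auto
    also have "\<dots> = ?c ^ 3"
      using c0 by (simp add: field_simps flip: power_add)
    finally have "?c ^ 6 * (p + q) \<le> p - q"
      using pq_bounds(2) by simp
    then have "p * cos (4 * (pi / (4 * real N))) + q \<le> ?c * (p - q)"
      using distortion_bound[of ?c "pi / (4 * real N)" p q] c pq by (simp add: c_def)
    moreover have "4 * (pi / (4 * real N)) = 2 * \<delta>"
      by (simp add: \<delta>_def)
    ultimately show ?thesis by simp
  qed

  \<comment> \<open>On the indices, \<open>T\<close> acts as \<open>i \<mapsto> \<psi> / \<delta> + \<sigma> * i\<close>. The window starts one below the integer part
    of the shift and so contains every integer at distance less than 2 from the image. By the choice
    of \<open>b\<close> the two circular parts of \<open>T\<close> form an angle of at most \<open>pi / 2\<close> for the \<open>N\<close>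
    indices from \<open>b\<close> on.\<close>
  define \<eta> where "\<eta> = (\<psi> - \<omega>) / (2 * \<delta>)"
  define k where "k = \<lfloor>\<psi> / \<delta>\<rfloor> - 1"
  define b where "b = \<lceil>- of_int \<sigma> * \<eta> - real N / 2\<rceil>"
  have "\<not> covered N \<sigma> k b A B"
    using misfits \<sigma> by (auto simp: misfits_def)
  then obtain i where i: "i \<in> {b..<b + int N}" "i mod (2 * int N) \<in> A"
    and gap: "\<And>e. e \<in> {0..<4} \<Longrightarrow> (k + \<sigma> * i + e) mod (2 * int N) \<notin> B"
    unfolding covered_def by blast
  define u where "u = T (dir (i * \<delta>))"
  have norm_u: "p\<^sup>2 + q\<^sup>2 \<le> (norm u)\<^sup>2"
  proof -
    have "- (real N / 2) \<le> i + \<sigma> * \<eta>" "i + \<sigma> * \<eta> \<le> real N / 2"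
      using i(1) unfolding b_def atLeastLessThan_iff by linarith+
    then have "\<bar>i + \<sigma> * \<eta>\<bar> \<le> real N / 2"
      by linarith
    then have "\<bar>\<sigma> * (i + \<sigma> * \<eta>)\<bar> \<le> real N / 2"
      using \<sigma> by (auto simp: abs_mult)
    then have "\<bar>\<sigma> * (i + \<sigma> * \<eta>)\<bar> * (2 * \<delta>) \<le> real N / 2 * (2 * \<delta>)"
      using \<delta> by (intro mult_right_mono) auto
    then have "\<bar>\<sigma> * (i + \<sigma> * \<eta>) * (2 * \<delta>)\<bar> \<le> pi / 2"
      using \<delta> N\<delta> by (simp add: abs_mult)
    moreover have "\<psi> + \<sigma> * (i * \<delta>) - (\<omega> - \<sigma> * (i * \<delta>)) = \<sigma> * (i + \<sigma> * \<eta>) * (2 * \<delta>)"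
      using \<sigma> \<delta> by (auto simp: \<eta>_def field_simps)
    ultimately have "0 \<le> cos (\<psi> + \<sigma> * (i * \<delta>) - (\<omega> - \<sigma> * (i * \<delta>)))"
      by (intro cos_ge_zero) (auto simp: abs_le_iff)
    then show ?thesis
      using pq unfolding u_def T norm_circular_sum by simp
  qed
  have "p - q \<le> norm u"
  proof (rule power2_le_imp_le)
    show "(p - q)\<^sup>2 \<le> (norm u)\<^sup>2"
      using norm_u mult_nonneg_nonneg[OF order_trans[OF pq] pq(1)] by (simp add: power2_diff)
  qed simp
  have "0 < norm u"
    using \<open>p - q \<le> norm u\<close> pq_bounds(2) c0 by (smt (verit) zero_less_power)
  \<comment> \<open>The image \<open>u\<close> is at angular distance at least \<open>pi / (4 * N)\<close> from all spikes of the second body.\<close>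
  have sep: "u \<bullet> dir (j * pi / (2 * N)) \<le> cos (pi / (4 * N)) * norm u"
    if j: "j mod (2 * int N) \<in> B" for j
  proof -
    have "cos ((\<psi> / \<delta> + \<sigma> * i - j) * \<delta>) \<le> cos (2 * \<delta>)"
    proof (rule ccontr)
      assume "\<not> ?thesis"
      then obtain t :: int where t: "\<bar>\<psi> / \<delta> + \<sigma> * i - j - 4 * real N * t\<bar> < 2"
        using cos_near_one_imp_near_period[OF N] unfolding \<delta>_def not_le by blast
      define e where "e = j + 4 * int N * t - \<sigma> * i - k"
      have "real_of_int e = j + 4 * real N * t - \<sigma> * i - k"
        by (simp add: e_def)
      moreover have "k + 1 \<le> \<psi> / \<delta>" "\<psi> / \<delta> < k + 2"
        unfolding k_def by linarith+
      ultimately have "-1 < real_of_int e" "real_of_int e < 4"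
        using t unfolding abs_less_iff by linarith+
      then have "e \<in> {0..<4}" by simp
      moreover have "k + \<sigma> * i + e = j + (2 * int N) * (2 * t)"
        by (simp add: e_def)
      then have "(k + \<sigma> * i + e) mod (2 * int N) = j mod (2 * int N)"
        by (simp only: mod_mult_self2)
      ultimately show False
        using gap j by metis
    qed
    also have "(\<psi> / \<delta> + \<sigma> * i - j) * \<delta> = \<psi> + \<sigma> * (i * \<delta>) - j * \<delta>"
      using \<delta> by (simp add: algebra_simps)
    finally have "u \<bullet> dir (j * \<delta>) \<le> p * cos (2 * \<delta>) + q * cos (\<omega> - \<sigma> * (i * \<delta>) - j * \<delta>)"
      using pq unfolding u_def T by (simp add: inner_add_left inner_dir mult_left_mono)
    also have "\<dots> \<le> p * cos (2 * \<delta>) + q"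
      using pq(1) cos_le_one by (simp add: mult_left_le)
    also have "\<dots> \<le> ?c * norm u"
      using distort mult_left_mono[OF \<open>p - q \<le> norm u\<close>, of ?c] c0 by linarith
    finally show ?thesis
      by (simp add: \<delta>_def c_def)
  qed
  have "T ((1 / cos (pi / (4 * N))) *\<^sub>R dir (i * pi / (2 * N))) \<in> (*\<^sub>R) s ` spiked_disc N B"
    using s(2) spike_in_spiked_disc[OF i(2)] by blast
  then obtain x where x: "x \<in> spiked_disc N B"
    "T ((1 / cos (pi / (4 * N))) *\<^sub>R dir (i * pi / (2 * N))) = s *\<^sub>R x"
    by blast
  then have "(1 / ?c) *\<^sub>R u = s *\<^sub>R x"
    by (simp add: linear_scale[OF \<open>linear T\<close>] u_def \<delta>_def c_def)
  then have "u \<bullet> ((1 / ?c) *\<^sub>R u) = s * (u \<bullet> x)"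
    by simp
  also have "\<dots> \<le> s * norm u"
    using spiked_disc_halfplane[OF sep _ x(1)] s(1) c0 by (simp add: c_def)
  finally have "norm u * norm u \<le> (s * ?c) * norm u"
    using c0 by (simp add: dot_square_norm power2_eq_square field_simps)
  then have "norm u \<le> s * ?c"
    using \<open>0 < norm u\<close> by (simp add: mult_le_cancel_right)
  then have "(norm u)\<^sup>2 \<le> (s * ?c)\<^sup>2"
    by (intro power_mono) auto
  then show ?thesis
    using norm_u mean_square_circular[OF T \<sigma>] by (simp add: power_mult_distrib)
qed

section \<open>The distance between discs with spikes\<close>

lemma spiked_disc_norm_le:
  assumes "N \<ge> 2" "x \<in> spiked_disc N A"
  shows "norm x \<le> 1 / cos (pi / (4 * N))"
  using subsetD[OF spiked_disc_subset_cball[OF assms(1)] assms(2)] by simp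

lemma norm_le_of_unit_bound:
  fixes T :: "real ^ 2 \<Rightarrow> real ^ 2"
  assumes "linear T" and "\<And>x. norm x \<le> 1 \<Longrightarrow> norm (T x) \<le> m"
  shows "norm (T x) \<le> norm x * m"
proof -
  obtain r t where "0 \<le> r" "x = r *\<^sub>R dir t"
    by (rule plane_polar)
  then show ?thesis
    using assms(2)[of "dir t"] by (simp add: linear_scale[OF assms(1)] mult_left_mono)
qed

text \<open>
If \<open>r \<le> 1 / c\<^sup>2\<close>, the inclusions force \<open>T\<close> and its inverse to be near-isometries. The bound on
quadratic means then applies to \<open>T\<close> with factor \<open>r\<close> and to the inverse with factor 1; since the two means have
product at least 1, so does \<open>r * c\<^sup>2\<close>.
\<close>

lemma banach_mazur_factor_ge:
  fixes T :: "real ^ 2 \<Rightarrow> real ^ 2"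
  defines "c \<equiv> \<lambda>N. cos (pi / (4 * real N))"
  assumes N: "N \<ge> 2" and misfits: "misfits N A B" "misfits N B A"
    and T: "linear T" "bij T" and "0 < r"
    and incl: "spiked_disc N A \<subseteq> T ` spiked_disc N B" "T ` spiked_disc N B \<subseteq> (*\<^sub>R) r ` spiked_disc N A"
  shows "1 / (c N)\<^sup>2 \<le> r"
proof (rule ccontr)
  let ?c = "c N"
  assume "\<not> ?thesis"
  then have r: "r \<le> 1 / ?c\<^sup>2" by simp
  have c: "0 < ?c" "?c \<le> 1"
    using cos_spike_bound[OF N] by (simp_all add: c_def)
  have inv: "inv T (T x) = x" "T (inv T x) = x" for x
    using T(2) by (simp_all add: bij_is_inj bij_is_surj surj_f_inv_f)
  have linv: "linear (inv T)"
    using linear_bij_inv(1)[OF T] .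
  have T_le: "norm (T x) \<le> norm x / ?c ^ 3" for x
  proof -
    have "norm (T y) \<le> 1 / ?c ^ 3" if y: "norm y \<le> 1" for y
    proof -
      have "T y \<in> (*\<^sub>R) r ` spiked_disc N A"
        using y incl(2) subsetD[OF cball_subset_spiked_disc, of y N B] by auto
      then obtain z where z: "z \<in> spiked_disc N A" "T y = r *\<^sub>R z" by blast
      have "norm (T y) = r * norm z"
        using z(2) \<open>0 < r\<close> by simp
      also have "\<dots> \<le> 1 / ?c\<^sup>2 * (1 / ?c)"
        using r spiked_disc_norm_le[OF N z(1)] \<open>0 < r\<close> c by (intro mult_mono) (auto simp: c_def)
      also have "\<dots> = 1 / ?c ^ 3"
        by (simp add: power2_eq_square power3_eq_cube)
      finally show ?thesis .
    qed
    from norm_le_of_unit_bound[OF T(1) this] show ?thesis by simp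
  qed
  have inv_le: "norm (inv T x) \<le> norm x / ?c ^ 3" for x
  proof -
    have "norm (inv T y) \<le> 1 / ?c ^ 3" if y: "norm y \<le> 1" for y
    proof -
      have "y \<in> T ` spiked_disc N B"
        using y incl(1) subsetD[OF cball_subset_spiked_disc, of y N A] by auto
      then have "inv T y \<in> spiked_disc N B"
        by (auto simp: inv)
      then have "norm (inv T y) \<le> 1 / ?c"
        using spiked_disc_norm_le[OF N] by (simp add: c_def)
      also have "\<dots> \<le> 1 / ?c ^ 3"
        using c power_decreasing[of 1 3 ?c] by (intro divide_left_mono) auto
      finally show ?thesis .
    qed
    from norm_le_of_unit_bound[OF linv this] show ?thesis by simp
  qed
  have "mean_square T \<le> r\<^sup>2 * ?c\<^sup>2"
    unfolding c_def
    by (rule mean_square_le_of_misfits[OF N misfits(2) T(1) _ _ \<open>0 < r\<close> incl(2)])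
      (use T_le inv_le[of "T _"] in \<open>auto simp: inv c_def\<close>)
  moreover have "mean_square (inv T) \<le> 1\<^sup>2 * ?c\<^sup>2"
    unfolding c_def
  proof (rule mean_square_le_of_misfits[OF N misfits(1) linv])
    show "inv T ` spiked_disc N A \<subseteq> (*\<^sub>R) 1 ` spiked_disc N B"
      using incl(1) by (auto simp: inv)
  qed (use inv_le T_le[of "inv T _"] in \<open>auto simp: inv c_def\<close>)
  moreover have "0 \<le> mean_square (inv T)"
    by (simp add: mean_square_def)
  ultimately have "mean_square T * mean_square (inv T) \<le> (r\<^sup>2 * ?c\<^sup>2) * (1\<^sup>2 * ?c\<^sup>2)"
    by (intro mult_mono) auto
  also have "\<dots> = (r * ?c\<^sup>2)\<^sup>2"
    by (simp add: power2_eq_square)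
  finally have "1\<^sup>2 \<le> (r * ?c\<^sup>2)\<^sup>2"
    using mean_square_inverse[of "inv T" T, OF linv inv(1)] by simp
  then have "1 \<le> r * ?c\<^sup>2"
    by (rule power2_le_imp_le) (use \<open>0 < r\<close> in simp)
  with \<open>\<not> 1 / ?c\<^sup>2 \<le> r\<close> c show False
    by (simp add: field_simps)
qed

text \<open>
The homothety with factor \<open>d\<close> attains \<open>d\<^sup>2\<close>, because all bodies lie between the discs of radius 1
and \<open>d\<close>.
\<close>

lemma banach_mazur_dist_spiked_disc:
  assumes N: "N \<ge> 2" and misfits: "misfits N A B" "misfits N B A"
  shows "banach_mazur_dist (spiked_disc N A) (spiked_disc N B) = (1 / cos (pi / (4 * real N)))\<^sup>2"
  unfolding banach_mazur_dist_def
proof (rule cInf_eq_minimum)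
  define d where "d = 1 / cos (pi / (4 * real N))"
  have "1 \<le> d"
    using cos_spike_bound[OF N] by (simp add: d_def)
  have scale: "spiked_disc N X \<subseteq> (*\<^sub>R) d ` spiked_disc N Y" for X Y
  proof
    fix x assume "x \<in> spiked_disc N X"
    then have "norm x \<le> d"
      using spiked_disc_norm_le[OF N] by (simp add: d_def)
    then have "(1 / d) *\<^sub>R x \<in> spiked_disc N Y"
      using \<open>1 \<le> d\<close> cball_subset_spiked_disc[of N Y] by (auto simp: divide_simps)
    then show "x \<in> (*\<^sub>R) d ` spiked_disc N Y"
      by (rule rev_image_eqI) (use \<open>1 \<le> d\<close> in simp)
  qed
  have "linear ((*\<^sub>R) d :: real ^ 2 \<Rightarrow> real ^ 2)"
    by (rule linear_scaleR)
  moreover have "bij ((*\<^sub>R) d :: real ^ 2 \<Rightarrow> real ^ 2)"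
    by (rule o_bij[of "(*\<^sub>R) (1 / d)"]) (use \<open>1 \<le> d\<close> in \<open>auto simp: fun_eq_iff\<close>)
  moreover have "(*\<^sub>R) d ` spiked_disc N B \<subseteq> (*\<^sub>R) (d\<^sup>2) ` spiked_disc N A"
    using image_mono[OF scale[of B A], of "(*\<^sub>R) d"] by (simp add: image_image power2_eq_square)
  ultimately show "(1 / cos (pi / (4 * real N)))\<^sup>2 \<in> {r. r > 0 \<and> (\<exists>T. linear T \<and> bij T \<and>
      spiked_disc N A \<subseteq> T ` spiked_disc N B \<and> T ` spiked_disc N B \<subseteq> (*\<^sub>R) r ` spiked_disc N A)}"
    using scale[of A B] \<open>1 \<le> d\<close> unfolding d_def[symmetric]
    by (intro CollectI conjI exI[of _ "(*\<^sub>R) d"]) auto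
next
  fix r assume "r \<in> {r. r > 0 \<and> (\<exists>T. linear T \<and> bij T \<and>
      spiked_disc N A \<subseteq> T ` spiked_disc N B \<and> T ` spiked_disc N B \<subseteq> (*\<^sub>R) r ` spiked_disc N A)}"
  then show "(1 / cos (pi / (4 * real N)))\<^sup>2 \<le> r"
    using banach_mazur_factor_ge[OF N misfits] by (auto simp: power_divide)
qed

lemma banach_mazur_dist_self_le: "banach_mazur_dist K K \<le> 1"
  unfolding banach_mazur_dist_def
proof (rule cInf_lower)
  show "1 \<in> {r. 0 < r \<and> (\<exists>T. linear T \<and> bij T \<and> K \<subseteq> T ` K \<and> T ` K \<subseteq> (*\<^sub>R) r ` K)}"
    using linear_id bij_id by (auto intro!: exI[of _ id])
  show "bdd_below {r. 0 < r \<and> (\<exists>T. linear T \<and> bij T \<and> K \<subseteq> T ` K \<and> T ` K \<subseteq> (*\<^sub>R) r ` K)}"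
    by (rule bdd_belowI[of _ 0]) auto
qed

section \<open>Equilateral sets in the compactum\<close>

text \<open>
A body is at distance at most 1 from itself, so bodies at distance \<open>\<delta> > 1\<close> lie in different
classes and passing to classes loses no elements.
\<close>

lemma equilateral_classes:
  fixes K :: "'i \<Rightarrow> 'a::euclidean_space set"
  assumes "finite F" and body: "\<And>A. A \<in> F \<Longrightarrow> symmetric_convex_body (K A)" and "1 < \<delta>"
    and dist: "\<And>A B. A \<in> F \<Longrightarrow> B \<in> F \<Longrightarrow> A \<noteq> B \<Longrightarrow> banach_mazur_dist (K A) (K B) = \<delta>"
  obtains E :: "'a set set set" where "E \<subseteq> banach_mazur_compactum" "finite E" "card E = card F"
    "equilateral banach_mazur_class_dist \<delta> E"
proof -
  define cls where "cls A = linear_equivalence `` {K A}" for A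
  have class_dist: "banach_mazur_class_dist (cls A) (cls B) = banach_mazur_dist (K A) (K B)"
    if "A \<in> F" "B \<in> F" for A B
    unfolding cls_def by (rule class_dist_eq) (use that body in auto)
  have "inj_on cls F"
  proof (rule inj_onI, rule ccontr)
    fix A B assume *: "A \<in> F" "B \<in> F" "cls A = cls B" "A \<noteq> B"
    then have "\<delta> = banach_mazur_dist (K A) (K A)"
      using class_dist[of A B] class_dist[of A A] dist[of A B] by simp
    with banach_mazur_dist_self_le[of "K A"] \<open>1 < \<delta>\<close> show False by simp
  qed
  show thesis
  proof (rule that[of "cls ` F"])
    show "cls ` F \<subseteq> banach_mazur_compactum"
      using body by (auto simp: cls_def banach_mazur_compactum_def intro: quotientI)
    show "equilateral banach_mazur_class_dist \<delta> (cls ` F)"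
      unfolding equilateral_def using class_dist dist by auto
  qed (use \<open>inj_on cls F\<close> \<open>finite F\<close> in \<open>auto simp: card_image\<close>)
qed

theorem theorem1:
  fixes C :: real and d :: "nat \<Rightarrow> real"
  assumes C: "C = root 20 (2 ^ 18 / (2 ^ 18 - 1))"
    and d: "\<And>N. N \<ge> 2 \<Longrightarrow> d N = 1 / cos (pi / (4 * real N))"
  shows "C > 1 \<and>
    (\<exists>N0\<ge>2. \<forall>N\<ge>N0. \<exists>E \<subseteq> (banach_mazur_compactum :: (real ^ 2) set set set).
       finite E \<and> real (card E) \<ge> C ^ N \<and>
       equilateral banach_mazur_class_dist ((d N)\<^sup>2) E)"
proof
  \<comment> \<open>The family has more than \<open>1.001 ^ N\<close> members, so it suffices that \<open>C\<close> lies below \<open>1.001\<close>.\<close>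
  have C20: "C ^ 20 = 2 ^ 18 / (2 ^ 18 - 1)"
    unfolding C by (rule real_root_pow_pos2) simp_all
  show "C > 1"
    unfolding C by (subst real_root_gt_1_iff) simp_all
  have "C \<le> C ^ 20"
    using power_increasing[of 1 20 C] \<open>C > 1\<close> by simp
  then have C_le: "C \<le> 1.001"
    unfolding C20 by simp
  obtain M where M: "\<And>N. N \<ge> M \<Longrightarrow>
      1.001 ^ N * (2 * (1 / 4) ^ N + 64 * (real N)\<^sup>2 * (31 / 32) ^ (N div 4)) < 1"
    using eventually_exponential_wins unfolding eventually_sequentially by blast
  show "\<exists>N0\<ge>2. \<forall>N\<ge>N0. \<exists>E \<subseteq> (banach_mazur_compactum :: (real ^ 2) set set set).
      finite E \<and> real (card E) \<ge> C ^ N \<and> equilateral banach_mazur_class_dist ((d N)\<^sup>2) E"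
  proof (intro exI[of _ "max 2 M"] conjI allI impI)
    fix N assume "N \<ge> max 2 M"
    then have N: "N \<ge> 2" "N \<ge> M" by auto
    let ?\<epsilon> = "2 * (1 / 4) ^ N + 64 * (real N)\<^sup>2 * (31 / 32) ^ (N div 4)"
    obtain F where F: "finite F" "\<And>A B. A \<in> F \<Longrightarrow> B \<in> F \<Longrightarrow> A \<noteq> B \<Longrightarrow> misfits N A B"
      and card: "1 \<le> real (card F) * ?\<epsilon>"
      using large_misfit_family[of N] N by auto
    have "C ^ N \<le> 1.001 ^ N"
      using C_le \<open>C > 1\<close> by (intro power_mono) auto
    also have "\<dots> \<le> 1.001 ^ N * (real (card F) * ?\<epsilon>)"
      using card by (simp add: mult_le_cancel_left1)
    also have "\<dots> = real (card F) * (1.001 ^ N * ?\<epsilon>)"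
      by (simp only: mult.left_commute)
    also have "\<dots> \<le> real (card F) * 1"
      using M[OF N(2)] by (intro mult_left_mono) auto
    finally have large: "C ^ N \<le> real (card F)" by simp
    have "1 < (d N)\<^sup>2"
      using cos_spike_bound[OF N(1)] by (simp add: d[OF N(1)] power_divide power_less_one_iff)
    then obtain E :: "(real ^ 2) set set set" where "E \<subseteq> banach_mazur_compactum" "finite E"
      "card E = card F" "equilateral banach_mazur_class_dist ((d N)\<^sup>2) E"
      by (rule equilateral_classes[OF F(1), of "spiked_disc N" "(d N)\<^sup>2", rotated])
        (use N F(2) in \<open>auto simp: d banach_mazur_dist_spiked_disc symmetric_convex_body_spiked_disc\<close>)
    with large show "\<exists>E \<subseteq> (banach_mazur_compactum :: (real ^ 2) set set set).
        finite E \<and> real (card E) \<ge> C ^ N \<and> equilateral banach_mazur_class_dist ((d N)\<^sup>2) E"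
      by (intro exI[of _ E] conjI) simp_all
  qed simp
qed

end
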